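(* Let $X$ be a partially ordered vector space and let $B$ be a base of $X_+$. If there exists a linear topology $\tau$ on $X$ such that $B$ is compact with respect to $\tau$, then all upper bounds of $B$ are net catching elements, i.e. interior points of $X_+$ with respect to the order topology $\tau_o(X)$.
   Context: A partially ordered vector space is a real vector space $X$ with a partial order $\leq$ such that $x\leq y$ implies $x+z\leq y+z$ and $\lambda x\leq\lambda y$ for all $z\in X$ and real $\lambda\geq 0$; $X_+=\{x\in X;\ x\geq 0\}$, and $[x,y]=\{z\in X;\ x\leq z\leq y\}$. A non-empty convex subset $B$ of $X_+\setminus\{0\}$ is a base of $X_+$ if for each $x\in X_+\setminus\{0\}$ there are unique $b\in B$ and real $\lambda>0$ with $x=\lambda b$. A linear topology on $X$ is a topology for which addition $X\times X\to X$ and scalar multiplication $\mathbb{R}\times X\to X$ are continuous. For a net $(x_\alpha)_{\alpha\in A}$ in $X$ we write $x_\alpha\downarrow 0$ if the net is decreasing ($\alpha\leq\beta$ implies $x_\beta\leq x_\alpha$) and $\inf_{\alpha\in A} x_\alpha=0$. A set $M\subseteq X$ is net catching for $x\in X$ if for every net $(x_\alpha)_{\alpha\in A}$ in $X$ with $x_\alpha\downarrow 0$ there is $\alpha\in A$ with $[x-x_\alpha,x+x_\alpha]\subseteq M$. A set $O\subseteq X$ is order open if it is net catching for every $x\in O$. The order topology is $\tau_o(X)=\{O\subseteq X;\ O\text{ order open}\}$. An element $y\in X$ is called net catching if for every net $(x_\alpha)_{\alpha\in A}$ in $X$ with $x_\alpha\downarrow 0$ there is $\alpha\in A$ with $x_\alpha\leq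 y$. *)

theory Defs
  imports "HOL-Analysis.Analysis"
begin

text \<open>A partially ordered vector space is a type of class \<^class>\<open>ordered_real_vector\<close>;
  its cone of positive elements is \<open>{0..}\<close> and the order interval between \<open>x\<close> and \<open>y\<close>
  is \<open>{x..y}\<close>.\<close>

definition base_of_cone :: "'a::ordered_real_vector set \<Rightarrow> bool" where
  "base_of_cone B \<longleftrightarrow>
     B \<noteq> {} \<and> convex B \<and> B \<subseteq> {0..} - {0} \<and>
     (\<forall>x \<in> {0..} - {0}. \<exists>!(b, c). b \<in> B \<and> c > (0::real) \<and> x = c *\<^sub>R b)"

text \<open>No separation axiom is required of a linear topology.\<close>

definition linear_topology :: "'a::real_vector topology \<Rightarrow> bool" where
  "linear_topology T \<longleftrightarrow>
     topspace T = UNIV \<and>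
     continuous_map (prod_topology T T) T (\<lambda>(x, y). x + y) \<and>
     continuous_map (prod_topology euclideanreal T) T (\<lambda>(c, x). c *\<^sub>R x)"

text \<open>Index sets of nets are non-empty, preordered and upward directed; antisymmetry is not
  required.\<close>

definition directed_index :: "'i set \<Rightarrow> ('i \<Rightarrow> 'i \<Rightarrow> bool) \<Rightarrow> bool" where
  "directed_index A le \<longleftrightarrow>
     A \<noteq> {} \<and> reflp_on A le \<and> transp_on A le \<and>
     (\<forall>\<alpha>\<in>A. \<forall>\<beta>\<in>A. \<exists>\<gamma>\<in>A. le \<alpha> \<gamma> \<and> le \<beta> \<gamma>)"

definition net_down_to_zero ::
  "'i set \<Rightarrow> ('i \<Rightarrow> 'i \<Rightarrow> bool) \<Rightarrow> ('i \<Rightarrow> 'a::ordered_real_vector) \<Rightarrow> bool" where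
  "net_down_to_zero A le x \<longleftrightarrow>
     directed_index A le \<and>
     (\<forall>\<alpha>\<in>A. \<forall>\<beta>\<in>A. le \<alpha> \<beta> \<longrightarrow> x \<beta> \<le> x \<alpha>) \<and>
     (\<forall>\<alpha>\<in>A. 0 \<le> x \<alpha>) \<and> (\<forall>z. (\<forall>\<alpha>\<in>A. z \<le> x \<alpha>) \<longrightarrow> z \<le> 0)"

text \<open>A definition cannot quantify over the type of indices, so the nets in the next two
  definitions are indexed by subsets of the space itself, with an arbitrary direction. This is no
  restriction: lemmas \<open>net_catching_for_any_index\<close> and \<open>net_catching_any_index\<close> below give the
  same property for nets over every index type, because a decreasing net can be replaced by its
  range, directed by the reversed order.\<close>

definition net_catching_for :: "'a::ordered_real_vector set \<Rightarrow> 'a \<Rightarrow> bool" where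
  "net_catching_for M x \<longleftrightarrow>
     (\<forall>(A :: 'a set) le u. net_down_to_zero A le u \<longrightarrow>
        (\<exists>\<alpha>\<in>A. {x - u \<alpha> .. x + u \<alpha>} \<subseteq> M))"

definition net_catching :: "'a::ordered_real_vector \<Rightarrow> bool" where
  "net_catching y \<longleftrightarrow>
     (\<forall>(A :: 'a set) le u. net_down_to_zero A le u \<longrightarrow> (\<exists>\<alpha>\<in>A. u \<alpha> \<le> y))"

definition order_open :: "'a::ordered_real_vector set \<Rightarrow> bool" where
  "order_open U \<longleftrightarrow> (\<forall>x\<in>U. net_catching_for U x)"

definition tau_o :: "'a::ordered_real_vector topology" where
  "tau_o = topology order_open"

lemma net_down_to_zero_range:
  assumes "net_down_to_zero A le u"
  shows "net_down_to_zero (u ` A) (\<lambda>a b. b \<le> a) (\<lambda>a. a)"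
proof -
  have "\<exists>c\<in>u ` A. c \<le> a \<and> c \<le> b" if ab: "a \<in> u ` A" "b \<in> u ` A" for a b
  proof -
    obtain i j where ij: "i \<in> A" "a = u i" "j \<in> A" "b = u j" using ab by auto
    then obtain k where "k \<in> A" "le i k" "le j k"
      using assms unfolding net_down_to_zero_def directed_index_def by blast
    then show ?thesis using assms ij unfolding net_down_to_zero_def by blast
  qed
  then show ?thesis
    using assms unfolding net_down_to_zero_def directed_index_def
    by (auto simp: reflp_on_def transp_on_def)
qed

lemma net_catching_for_any_index:
  fixes A :: "'i set"
  assumes "net_catching_for M x" and "net_down_to_zero A le u"
  shows "\<exists>\<alpha>\<in>A. {x - u \<alpha> .. x + u \<alpha>} \<subseteq> M"
proof -
  have "\<exists>a \<in> u ` A. {x - a .. x + a} \<subseteq> M"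
    using assms(1) net_down_to_zero_range[OF assms(2)] unfolding net_catching_for_def by blast
  then show ?thesis by blast
qed

lemma net_catching_any_index:
  fixes A :: "'i set"
  assumes "net_catching y" and "net_down_to_zero A le u"
  shows "\<exists>\<alpha>\<in>A. u \<alpha> \<le> y"
proof -
  have "\<exists>a \<in> u ` A. a \<le> y"
    using assms(1) net_down_to_zero_range[OF assms(2)] unfolding net_catching_def by blast
  then show ?thesis by blast
qed

lemma istopology_order_open: "istopology (order_open :: 'a::ordered_real_vector set \<Rightarrow> bool)"
  unfolding istopology_def
proof (intro conjI allI impI)
  fix S T :: "'a set"
  assume ST: "order_open S" "order_open T"
  show "order_open (S \<inter> T)"
    unfolding order_open_def net_catching_for_def
  proof (intro ballI allI impI)
    fix x :: "'a" and A :: "'a set" and le and u :: "'a \<Rightarrow> 'a"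
    assume x: "x \<in> S \<inter> T" and net: "net_down_to_zero A le u"
    obtain i where i: "i \<in> A" "{x - u i .. x + u i} \<subseteq> S"
      using ST(1) x net unfolding order_open_def net_catching_for_def by blast
    obtain j where j: "j \<in> A" "{x - u j .. x + u j} \<subseteq> T"
      using ST(2) x net unfolding order_open_def net_catching_for_def by blast
    obtain k where k: "k \<in> A" "le i k" "le j k"
      using net i(1) j(1) unfolding net_down_to_zero_def directed_index_def by blast
    have le: "u k \<le> u i" "u k \<le> u j"
      using net i(1) j(1) k unfolding net_down_to_zero_def by blast+
    have "{x - u k .. x + u k} \<subseteq> {x - u i .. x + u i}"
         "{x - u k .. x + u k} \<subseteq> {x - u j .. x + u j}"
      using le by (simp_all add: atLeastatMost_subset_iff diff_left_mono)
    then show "\<exists>\<alpha>\<in>A. {x - u \<alpha> .. x + u \<alpha>} \<subseteq> S \<inter> T"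
      using i j k(1) by blast
  qed
next
  fix K :: "'a set set"
  assume K: "\<forall>S\<in>K. order_open S"
  show "order_open (\<Union>K)"
    unfolding order_open_def net_catching_for_def
  proof (intro ballI allI impI)
    fix x :: "'a" and A :: "'a set" and le and u :: "'a \<Rightarrow> 'a"
    assume x: "x \<in> \<Union>K" and net: "net_down_to_zero A le u"
    then obtain S where S: "S \<in> K" "x \<in> S" by blast
    then obtain i where "i \<in> A" "{x - u i .. x + u i} \<subseteq> S"
      using K net unfolding order_open_def net_catching_for_def by blast
    then show "\<exists>\<alpha>\<in>A. {x - u \<alpha> .. x + u \<alpha>} \<subseteq> \<Union>K" using S(1) by blast
  qed
qed

lemma openin_tau_o: "openin tau_o = order_open"
  unfolding tau_o_def by (rule topology_inverse'[OF istopology_order_open])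

lemma topspace_tau_o: "topspace tau_o = UNIV"
proof -
  have "openin tau_o UNIV"
    unfolding openin_tau_o order_open_def net_catching_for_def net_down_to_zero_def
      directed_index_def by blast
  then show ?thesis using openin_subset by blast
qed

end

theory Submission
  imports Defs
begin

text \<open>A base of the cone is the level set \<open>f = 1\<close> of an additive functional \<open>f\<close> on the cone, and an
  upper bound \<open>y\<close> of the base satisfies \<open>x \<le> f x *\<^sub>R y\<close> for all \<open>x \<ge> 0\<close>. If \<open>u\<close> decreases to zero,
  then \<open>f \<circ> u\<close> decreases to some real number. Pick \<open>\<alpha>\<close> with \<open>f (u \<alpha>)\<close> within \<open>e\<close> of that number. For
  all later \<open>\<beta>\<close> we get \<open>u \<alpha> - u \<beta> \<le> f (u \<alpha> - u \<beta>) *\<^sub>R y \<le> e *\<^sub>R y\<close>, so \<open>u \<alpha> - e *\<^sub>R y\<close> is a lower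
  bound of the net and hence \<open>u \<alpha> \<le> e *\<^sub>R y\<close>. The elements lying above some positive multiple of
  \<open>y\<close> then form an order open subset of the cone.\<close>

text \<open>The value \<open>f x\<close> is the coefficient of \<open>x\<close> over the base.
  Additivity comes from convexity: dividing \<open>x + y\<close> by the sum of the two coefficients
  gives a convex combination of base elements.\<close>

lemma base_of_cone_functional:
  fixes B :: "'a::ordered_real_vector set"
  assumes "base_of_cone B"
  obtains f :: "'a \<Rightarrow> real"
  where "\<And>x. 0 \<le> x \<Longrightarrow> 0 \<le> f x"
    and "\<And>x. 0 \<le> x \<Longrightarrow> \<exists>b\<in>B. x = f x *\<^sub>R b"
    and "\<And>x y. 0 \<le> x \<Longrightarrow> 0 \<le> y \<Longrightarrow> f (x + y) = f x + f y"
proof -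
  have "B \<noteq> {}" and "convex B" and pos: "\<And>b. b \<in> B \<Longrightarrow> 0 \<le> b \<and> b \<noteq> 0"
    and unique: "\<And>x. 0 \<le> x \<Longrightarrow> x \<noteq> 0 \<Longrightarrow>
                   \<exists>!(b, c). b \<in> B \<and> c > (0::real) \<and> x = c *\<^sub>R b"
    using assms unfolding base_of_cone_def by auto
  have "\<exists>c\<ge>0. \<exists>b\<in>B. x = c *\<^sub>R b" if "0 \<le> x" for x
  proof (cases "x = 0")
    case True
    then show ?thesis using \<open>B \<noteq> {}\<close> by (auto intro!: exI[of _ 0])
  next
    case False
    then show ?thesis using unique[OF that] by (auto intro: less_imp_le)
  qed
  then obtain f where f: "\<And>x. 0 \<le> x \<Longrightarrow> 0 \<le> f x \<and> (\<exists>b\<in>B. x = f x *\<^sub>R b)"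
    by metis
  \<comment> \<open>\<open>f\<close> was only chosen, so its values must be pinned down. For
    \<open>c > 0\<close> the representation is unique; for \<open>c = 0\<close> the coefficient
    vanishes because base elements are nonzero.\<close>
  have f_eq: "f (c *\<^sub>R b) = c" if "0 \<le> c" "b \<in> B" for c b
  proof -
    have nonneg: "0 \<le> c *\<^sub>R b" using that pos by (simp add: scaleR_nonneg_nonneg)
    then obtain b' where b': "b' \<in> B" "c *\<^sub>R b = f (c *\<^sub>R b) *\<^sub>R b'" "0 \<le> f (c *\<^sub>R b)"
      using f by blast
    show ?thesis
    proof (cases "c = 0")
      case True
      then show ?thesis using b' pos by auto
    next
      case False
      then have nz: "c *\<^sub>R b \<noteq> 0" and "0 < c" using that pos by auto
      moreover have "0 < f (c *\<^sub>R b)" using nz b' by (cases "f (c *\<^sub>R b) = 0") auto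
      ultimately show ?thesis using unique[OF nonneg nz] that b' by blast
    qed
  qed
  have "f (x + y) = f x + f y" if xy: "0 \<le> x" "0 \<le> y" for x y
  proof -
    obtain b b' where b: "b \<in> B" "x = f x *\<^sub>R b" "b' \<in> B" "y = f y *\<^sub>R b'"
      using f xy by meson
    have nonneg: "0 \<le> f x" "0 \<le> f y" using f xy by auto
    show ?thesis
    proof (cases "f x + f y = 0")
      case True
      then have "f x = 0" "f y = 0" using nonneg by auto
      then have "x = 0" "y = 0" using b by auto
      then show ?thesis using f_eq[of 0 b] b by auto
    next
      case False
      let ?s = "f x + f y"
      \<comment> \<open>The weights are nonnegative and sum to 1, so \<open>?b\<close> stays in
        \<open>B\<close>, and \<open>f_eq\<close> reads off the coefficient \<open>?s\<close> of
        \<open>x + y\<close>.\<close>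
      let ?b = "(f x / ?s) *\<^sub>R b + (f y / ?s) *\<^sub>R b'"
      have "?b \<in> B"
        using \<open>convex B\<close> b nonneg False
        by (intro convexD) (auto simp: add_divide_distrib[symmetric])
      moreover have "?s *\<^sub>R ?b = x + y"
        using b False by (simp add: scaleR_add_right)
      ultimately show ?thesis using f_eq[of ?s ?b] nonneg by simp
    qed
  qed
  then show thesis using that f by blast
qed

text \<open>The free factor \<open>e\<close> serves two ends: \<open>e = 1\<close> gives net
  catching, and small \<open>e\<close> gives order openness.\<close>

lemma net_eventually_le_scaled_upper_bound:
  fixes B :: "'a::ordered_real_vector set"
  assumes "base_of_cone B" and y: "\<And>b. b \<in> B \<Longrightarrow> b \<le> y"
    and net: "net_down_to_zero A le u" and e: "0 < e"
  shows "\<exists>\<alpha>\<in>A. u \<alpha> \<le> e *\<^sub>R y"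
proof -
  obtain f :: "'a \<Rightarrow> real" where f_nonneg: "\<And>x. 0 \<le> x \<Longrightarrow> 0 \<le> f x"
    and f_base: "\<And>x. 0 \<le> x \<Longrightarrow> \<exists>b\<in>B. x = f x *\<^sub>R b"
    and f_add: "\<And>x y. 0 \<le> x \<Longrightarrow> 0 \<le> y \<Longrightarrow> f (x + y) = f x + f y"
    using base_of_cone_functional[OF assms(1)] by metis
  \<comment> \<open>\<open>y\<close> dominates some element of the nonempty base. This sign later
    allows the coefficient of \<open>y\<close> to be enlarged to \<open>e\<close>.\<close>
  have "0 \<le> y"
    using assms(1) y unfolding base_of_cone_def by fastforce
  have le_y: "x \<le> f x *\<^sub>R y" if x: "0 \<le> x" for x
  proof -
    obtain b where "b \<in> B" "x = f x *\<^sub>R b" using f_base[OF x] by blast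
    then show ?thesis by (metis f_nonneg[OF x] scaleR_left_mono y)
  qed
  have decr: "u \<beta> \<le> u \<alpha>" if "\<alpha> \<in> A" "\<beta> \<in> A" "le \<alpha> \<beta>" for \<alpha> \<beta>
    using net that unfolding net_down_to_zero_def by blast
  have u_nonneg: "0 \<le> u \<alpha>" if "\<alpha> \<in> A" for \<alpha>
    using net that unfolding net_down_to_zero_def by blast
  have "A \<noteq> {}" using net unfolding net_down_to_zero_def directed_index_def by blast
  have bdd: "bdd_below ((\<lambda>\<alpha>. f (u \<alpha>)) ` A)"
    using f_nonneg u_nonneg by (intro bdd_belowI[of _ 0]) auto
  obtain \<alpha> where \<alpha>: "\<alpha> \<in> A" "f (u \<alpha>) < (INF \<alpha>\<in>A. f (u \<alpha>)) + e"
    using cINF_less_iff[OF \<open>A \<noteq> {}\<close> bdd, of "(INF \<alpha>\<in>A. f (u \<alpha>)) + e"] e by auto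
  have "u \<alpha> - e *\<^sub>R y \<le> u \<beta>" if \<beta>: "\<beta> \<in> A" for \<beta>
  proof -
    \<comment> \<open>\<open>\<alpha>\<close> and \<open>\<beta>\<close> may be incomparable, so
      they are compared through a common later index.\<close>
    obtain \<gamma> where \<gamma>: "\<gamma> \<in> A" "le \<alpha> \<gamma>" "le \<beta> \<gamma>"
      using net \<alpha>(1) \<beta> unfolding net_down_to_zero_def directed_index_def by blast
    have diff: "0 \<le> u \<alpha> - u \<gamma>" using decr[OF \<alpha>(1) \<gamma>(1,2)] by simp
    have "f (u \<alpha>) = f (u \<alpha> - u \<gamma>) + f (u \<gamma>)"
      using f_add[OF diff u_nonneg[OF \<gamma>(1)]] by simp
    moreover have "(INF \<alpha>\<in>A. f (u \<alpha>)) \<le> f (u \<gamma>)" by (rule cINF_lower[OF bdd \<gamma>(1)])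
    ultimately have "f (u \<alpha> - u \<gamma>) \<le> e" using \<alpha>(2) by linarith
    then have "u \<alpha> - u \<gamma> \<le> e *\<^sub>R y"
      using le_y[OF diff] \<open>0 \<le> y\<close> by (meson order_trans scaleR_right_mono)
    then have "u \<alpha> - e *\<^sub>R y \<le> u \<gamma>" by (simp add: algebra_simps)
    also have "u \<gamma> \<le> u \<beta>" using decr[OF \<beta> \<gamma>(1,3)] .
    finally show ?thesis .
  qed
  then have "u \<alpha> - e *\<^sub>R y \<le> 0" using net unfolding net_down_to_zero_def by blast
  then show ?thesis using \<alpha>(1) by auto
qed

text \<open>If \<open>z\<close> lies above \<open>e *\<^sub>R y\<close>, half of this multiple
  absorbs the radius \<open>u \<alpha>\<close> and the other half still bounds the whole interval
  from below.\<close>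

lemma order_open_above_positive_multiple:
  fixes y :: "'a::ordered_real_vector"
  assumes small: "\<And>(A :: 'a set) le u e. net_down_to_zero A le u \<Longrightarrow> 0 < e \<Longrightarrow> \<exists>\<alpha>\<in>A. u \<alpha> \<le> e *\<^sub>R y"
  shows "order_open {z. \<exists>e>0. e *\<^sub>R y \<le> z}"
  unfolding order_open_def net_catching_for_def
proof (intro ballI allI impI)
  fix z :: 'a and A :: "'a set" and le and u :: "'a \<Rightarrow> 'a"
  assume z: "z \<in> {z. \<exists>e>0. e *\<^sub>R y \<le> z}" and net: "net_down_to_zero A le u"
  obtain e where e: "0 < e" "e *\<^sub>R y \<le> z" using z by blast
  obtain \<alpha> where \<alpha>: "\<alpha> \<in> A" "u \<alpha> \<le> (e/2) *\<^sub>R y" using small[OF net, of "e/2"] e by auto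
  have "(e/2) *\<^sub>R y = e *\<^sub>R y - (e/2) *\<^sub>R y" by (simp flip: scaleR_left_diff_distrib)
  also have "\<dots> \<le> z - u \<alpha>" using e(2) \<alpha>(2) by (rule diff_mono)
  finally have half: "(e/2) *\<^sub>R y \<le> z - u \<alpha>" .
  have "{z - u \<alpha>..z + u \<alpha>} \<subseteq> {z. \<exists>e>0. e *\<^sub>R y \<le> z}"
  proof
    fix w assume "w \<in> {z - u \<alpha>..z + u \<alpha>}"
    then have "(e/2) *\<^sub>R y \<le> w" using order_trans[OF half] by simp
    then show "w \<in> {z. \<exists>e>0. e *\<^sub>R y \<le> z}" using half_gt_zero[OF e(1)] by blast
  qed
  then show "\<exists>\<alpha>\<in>A. {z - u \<alpha>..z + u \<alpha>} \<subseteq> {z. \<exists>e>0. e *\<^sub>R y \<le> z}"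
    using \<alpha>(1) by blast
qed

theorem theorem4p5:
  fixes B :: "'a::ordered_real_vector set"
  assumes "base_of_cone B"
    and "\<exists>T :: 'a topology. linear_topology T \<and> compactin T B"
  shows "\<forall>y. (\<forall>b\<in>B. b \<le> y) \<longrightarrow> net_catching y \<and> y \<in> tau_o interior_of {0..}"
proof (intro allI impI)
  fix y assume "\<forall>b\<in>B. b \<le> y"
  then have y: "\<And>b. b \<in> B \<Longrightarrow> b \<le> y" by blast
  have small: "\<exists>\<alpha>\<in>A. u \<alpha> \<le> e *\<^sub>R y" if "net_down_to_zero A le u" "0 < e"
    for A :: "'a set" and le u e
    using assms(1) y that by (rule net_eventually_le_scaled_upper_bound)
  \<comment> \<open>\<open>?U\<close> is the order open set inside the cone that witnesses
    \<open>y\<close> as an interior point; \<open>y\<close> belongs to it with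
    \<open>e = 1\<close>.\<close>
  let ?U = "{z. \<exists>e>0. e *\<^sub>R y \<le> z}"
  have "net_catching y"
    unfolding net_catching_def using small[OF _ zero_less_one] by (simp only: scaleR_one) blast
  moreover have "0 \<le> y"
    using assms(1) y unfolding base_of_cone_def by fastforce
  then have "?U \<subseteq> {0..}"
    using order_trans[OF scaleR_nonneg_nonneg[OF less_imp_le]] by blast
  moreover have "openin tau_o ?U"
    unfolding openin_tau_o by (rule order_open_above_positive_multiple[OF small])
  moreover have "y \<in> ?U" by (auto intro!: exI[of _ 1])
  ultimately show "net_catching y \<and> y \<in> tau_o interior_of {0..}"
    unfolding interior_of_def by blast
qed

end
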